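(* Let $(G,u,c,B)$ be an instance of (BMFNI) on a two-terminal series-parallel graph $G$ with $m$ arcs, given together with a decomposition tree $T_G$, and let $U$ be the maximum of all capacities $u^1(a),u^2(a)$, $a\in A$. The dynamic programming algorithm that computes, bottom-up along $T_G$, the label sets $L(H,x)$ for all graphs $H$ in $T_G$ and all $x\in\{0,1,\dots,B\}$ according to (1) if $H$ is primitive with single arc $a^*$: $L(H,x)=\{(u^1(a^* ),u^2(a^* ))\}$ if $x<c(a^* )$, and $L(H,x)=\{(0,0)\}$ if $x\geq c(a^* )$; (2) if $H$ is the parallel composition of $H_1$ and $H_2$: $L(H,x)=\min\big\{\bigcup_{k=0}^x L(H_1,k)\oplus L(H_2,x-k)\big\}$; (3) if $H$ is the series composition of $H_1$ and $H_2$: $L(H,x)=\min\big\{\bigcup_{k=0}^x L(H_1,k)\odot L(H_2,x-k)\big\}$, and returns $L(G,B)$, has a worst-case running-time complexity of $\mathcal{O}(B^2m^3U^2\log(BmU))$.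
   Context: $\mathbb{N}$ includes $0$. Graphs are directed and parallel arcs are allowed. An instance $(G,u,c,B)$ of the biobjective maximum flow network interdiction problem (BMFNI) consists of a directed graph $G=(V,A)$ with $m=|A|$ arcs, a source $s\in V$ and a sink $t\in V$, $s\neq t$, two arc capacity functions $u=(u^1,u^2)\colon A\to\mathbb{N}^2$, interdiction costs $c(a)\in\mathbb{N}$ for $a\in A$, and an interdiction budget $B\in\mathbb{N}$. The problem asks for the set of non-dominated vectors of maximum $s$-$t$-flow values (with respect to $u^1$ and $u^2$) over all graphs obtained from $G$ by deleting a set of arcs of total interdiction cost at most $B$. For $y,z\in\mathbb{N}^2$, $y\leq z$ means $y_k\leq z_k$ for $k=1,2$ and $y\neq z$. For a finite set $S\subset\mathbb{N}^2$, $\min S$ denotes the set of all $z\in S$ for which there is no $y\in S$ with $y\leq z$. In the algorithm all candidate labels in the unions are generated and dominated ones are then discarded. For $R,S\subset\mathbb{R}^2$: $R\oplus S=\{r+s\mid r\in R,s\in S\}$ (Minkowski sum), and $R\odot S=\{r\odot s\mid r\in R,s\in S\}$ with $r\odot s=(\min\{r^1,s^1\},\min\{r^2,s^2\})$ for $r=(r^1,r^2)$, $s=(s^1,s^2)$. A directed graph with source $s$ and sink $t$ is two-terminal series-parallel if it can be built by the following operations: (i) the primitive graph with vertices $s,t$ and single arc $(s,t)$; (ii) parallel composition of two such graphs $G_1$ (source $s_1$, sink $t_1$) and $G_2$ (source $s_2$, sink $t_2$), identifying $s=s_1=s_2$ and $t=t_1=t_2$; (iii) series composition, identifying $s=s_1$,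 $t_1=s_2$, $t=t_2$. The decomposition tree $T_G$ is the binary tree recording such a construction of $G$: each vertex of $T_G$ corresponds to a two-terminal series-parallel subgraph $H$ of $G$, leaves correspond to primitive graphs (one per arc), each inner vertex is the series or parallel composition of its two children, and the root is $G$. "$H$ in $T_G$" means $H$ is the graph of some vertex of $T_G$. Running time counts elementary arithmetic operations and comparisons on integers; the $\mathcal{O}$-notation is asymptotic in $B,m,U$. *)

theory Defs
  imports
    "HOL-Library.Landau_Symbols"
    "HOL-Library.Monad_Syntax"
    "HOL-Library.Product_Order"
    "HOL-Library.Product_Plus"
    "Graph_Theory.Graph_Theory"
begin

section \<open>Instances on two-terminal series-parallel graphs\<close>

type_synonym label = "nat \<times> nat"

record ('v, 'a) bmfni =
  graph  :: "('v, 'a) pre_digraph"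
  source :: 'v
  sink   :: 'v
  cap    :: "'a \<Rightarrow> label"
  cost   :: "'a \<Rightarrow> nat"
  budget :: nat

definition bmfni_instance :: "('v, 'a) bmfni \<Rightarrow> bool" where
  "bmfni_instance I \<longleftrightarrow>
     fin_digraph (graph I) \<and> source I \<in> verts (graph I) \<and> sink I \<in> verts (graph I) \<and>
     source I \<noteq> sink I"

definition num_arcs :: "('v, 'a) bmfni \<Rightarrow> nat" where
  "num_arcs I = card (arcs (graph I))"

definition max_cap :: "('v, 'a) bmfni \<Rightarrow> nat" where
  "max_cap I = Max (\<Union>a\<in>arcs (graph I). {fst (cap I a), snd (cap I a)})"

datatype 'a decomp_tree =
    Primitive 'a
  | Parallel "'a decomp_tree" "'a decomp_tree"
  | Series "'a decomp_tree" "'a decomp_tree"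

text \<open>
  \<open>decomposes T H s t\<close>: \<open>T\<close> is a decomposition tree of the two-terminal series-parallel graph
  \<open>H\<close> with source \<open>s\<close> and sink \<open>t\<close>.  Since the graphs in the tree are subgraphs of one graph, the
  identification of terminals in a composition is expressed by taking the union of two
  arc-disjoint graphs that share precisely the identified vertices.
\<close>

inductive decomposes ::
    "'a decomp_tree \<Rightarrow> ('v, 'a) pre_digraph \<Rightarrow> 'v \<Rightarrow> 'v \<Rightarrow> bool" where
  primitive:
    "\<lbrakk> s \<noteq> t; verts H = {s, t}; arcs H = {a}; tail H a = s; head H a = t \<rbrakk>
     \<Longrightarrow> decomposes (Primitive a) H s t"
| parallel:
    "\<lbrakk> decomposes T1 H1 s t; decomposes T2 H2 s t; compatible H1 H2;
       verts H1 \<inter> verts H2 = {s, t}; arcs H1 \<inter> arcs H2 = {} \<rbrakk>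
     \<Longrightarrow> decomposes (Parallel T1 T2) (union H1 H2) s t"
| series:
    "\<lbrakk> decomposes T1 H1 s v; decomposes T2 H2 v t; compatible H1 H2;
       verts H1 \<inter> verts H2 = {v}; arcs H1 \<inter> arcs H2 = {} \<rbrakk>
     \<Longrightarrow> decomposes (Series T1 T2) (union H1 H2) s t"

definition sp_instances :: "nat \<Rightarrow> nat \<Rightarrow> nat \<Rightarrow> (('v, 'a) bmfni \<times> 'a decomp_tree) set" where
  "sp_instances B m U =
     {(I, T). bmfni_instance I \<and> decomposes T (graph I) (source I) (sink I) \<and>
        budget I = B \<and> num_arcs I = m \<and> max_cap I = U}"


section \<open>The label sets\<close>

text \<open>
  The order on pairs is the componentwise one, so \<open><\<close> is ``\<open>\<le>\<close> in both components and different'',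
  and \<open>inf\<close> is the componentwise minimum.
\<close>

definition min_set :: "label set \<Rightarrow> label set" where
  "min_set S = {z \<in> S. \<not> (\<exists>y\<in>S. y < z)}"

definition oplus :: "label set \<Rightarrow> label set \<Rightarrow> label set" where
  "oplus R S = {r + s | r s. r \<in> R \<and> s \<in> S}"

definition odot :: "label set \<Rightarrow> label set \<Rightarrow> label set" where
  "odot R S = {inf r s | r s. r \<in> R \<and> s \<in> S}"

primrec labels :: "('a \<Rightarrow> label) \<Rightarrow> ('a \<Rightarrow> nat) \<Rightarrow> 'a decomp_tree \<Rightarrow> nat \<Rightarrow> label set" where
  "labels u c (Primitive a) x = (if x < c a then {u a} else {(0, 0)})"
| "labels u c (Parallel T1 T2) x =
     min_set (\<Union>k\<in>{0..x}. oplus (labels u c T1 k) (labels u c T2 (x - k)))"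
| "labels u c (Series T1 T2) x =
     min_set (\<Union>k\<in>{0..x}. odot (labels u c T1 k) (labels u c T2 (x - k)))"


section \<open>The algorithm with its running time\<close>

text \<open>
  A timed computation is a result paired with the number of elementary arithmetic operations and
  comparisons on integers performed.  In the programs below every such operation is
  wrapped in \<open>step\<close>, at unit cost; operations that only rearrange or access lists
  involve no integer arithmetic and are not counted.
\<close>

type_synonym 'a timed = "'a \<times> nat"

definition ret :: "'a \<Rightarrow> 'a timed" where
  "ret v = (v, 0)"

definition step :: "'a \<Rightarrow> 'a timed" where
  "step v = (v, 1)"

definition bind_timed :: "'a timed \<Rightarrow> ('a \<Rightarrow> 'b timed) \<Rightarrow> 'b timed" where
  "bind_timed p f = (fst (f (fst p)), snd p + snd (f (fst p)))"

adhoc_overloading Monad_Syntax.bind \<rightleftharpoons> bind_timed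

primrec map_timed :: "('a \<Rightarrow> 'b timed) \<Rightarrow> 'a list \<Rightarrow> 'b list timed" where
  "map_timed f [] = ret []"
| "map_timed f (x # xs) = do { y \<leftarrow> f x; ys \<leftarrow> map_timed f xs; ret (y # ys) }"

text \<open>The loop over \<open>k = 0, \<dots>, n\<close>; each iteration tests and increments the counter.\<close>

definition for_upto :: "nat \<Rightarrow> (nat \<Rightarrow> 'b timed) \<Rightarrow> 'b list timed" where
  "for_upto n f =
     map_timed (\<lambda>k. do { _ \<leftarrow> step (k \<le> n); y \<leftarrow> f k; _ \<leftarrow> step (k + 1); ret y }) [0..<n + 1]"

text \<open>
  Dominated labels (and duplicates) are discarded by merge sort with respect to the lexicographic
  order, followed by one pass that keeps a label iff its second component is smaller than that of
  the label kept last.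
\<close>

definition lex_le :: "label \<Rightarrow> label \<Rightarrow> bool timed" where
  "lex_le y z = do {
     lt \<leftarrow> step (fst y < fst z);
     if lt then ret True
     else do {
       eq \<leftarrow> step (fst y = fst z);
       if eq then step (snd y \<le> snd z) else ret False
     }
   }"

fun merge_timed :: "label list \<Rightarrow> label list \<Rightarrow> label list timed" where
  "merge_timed [] ys = ret ys"
| "merge_timed (x # xs) [] = ret (x # xs)"
| "merge_timed (x # xs) (y # ys) = do {
     le \<leftarrow> lex_le x y;
     if le then do { zs \<leftarrow> merge_timed xs (y # ys); ret (x # zs) }
     else do { zs \<leftarrow> merge_timed (x # xs) ys; ret (y # zs) }
   }"

fun halve :: "'a list \<Rightarrow> 'a list \<times> 'a list" where
  "halve [] = ([], [])"
| "halve [x] = ([x], [])"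
| "halve (x # y # xs) = (x # fst (halve xs), y # snd (halve xs))"

lemma length_fst_halve: "length (fst (halve xs)) = (length xs + 1) div 2"
  by (induction xs rule: halve.induct) auto

lemma length_snd_halve: "length (snd (halve xs)) = length xs div 2"
  by (induction xs rule: halve.induct) auto

function msort_timed :: "label list \<Rightarrow> label list timed" where
  "msort_timed [] = ret []"
| "msort_timed [x] = ret [x]"
| "msort_timed (x # y # xs) = do {
     ys \<leftarrow> msort_timed (fst (halve (x # y # xs)));
     zs \<leftarrow> msort_timed (snd (halve (x # y # xs)));
     merge_timed ys zs
   }"
  by pat_completeness auto
termination
  by (relation "measure length") (auto simp: length_fst_halve length_snd_halve)

primrec sweep :: "label \<Rightarrow> label list \<Rightarrow> label list timed" where
  "sweep z [] = ret []"
| "sweep z (y # ys) = do {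
     lt \<leftarrow> step (snd y < snd z);
     if lt then do { zs \<leftarrow> sweep y ys; ret (y # zs) } else sweep z ys
   }"

definition discard_dominated :: "label list \<Rightarrow> label list timed" where
  "discard_dominated xs = do {
     ys \<leftarrow> msort_timed xs;
     (case ys of
        [] \<Rightarrow> ret []
      | z # zs \<Rightarrow> do { ws \<leftarrow> sweep z zs; ret (z # ws) })
   }"

definition add_label :: "label \<Rightarrow> label \<Rightarrow> label timed" where
  "add_label r s = do { a \<leftarrow> step (fst r + fst s); b \<leftarrow> step (snd r + snd s); ret (a, b) }"

definition min_label :: "label \<Rightarrow> label \<Rightarrow> label timed" where
  "min_label r s = do { a \<leftarrow> step (min (fst r) (fst s)); b \<leftarrow> step (min (snd r) (snd s)); ret (a, b) }"

definition all_pairs ::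
    "(label \<Rightarrow> label \<Rightarrow> label timed) \<Rightarrow> label list \<Rightarrow> label list \<Rightarrow> label list timed" where
  "all_pairs f R S = do { zss \<leftarrow> map_timed (\<lambda>r. map_timed (f r) S) R; ret (concat zss) }"

text \<open>Entry \<open>x\<close> of a table holds the label set for budget \<open>x\<close>, for \<open>x = 0, \<dots>, B\<close>.\<close>

type_synonym table = "label list list"

definition combine ::
    "(label \<Rightarrow> label \<Rightarrow> label timed) \<Rightarrow> nat \<Rightarrow> table \<Rightarrow> table \<Rightarrow> table timed" where
  "combine f B L1 L2 = for_upto B (\<lambda>x. do {
     cands \<leftarrow> for_upto x (\<lambda>k. do { j \<leftarrow> step (x - k); all_pairs f (L1 ! k) (L2 ! j) });
     discard_dominated (concat cands)
   })"

primrec dp_table ::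
    "('a \<Rightarrow> label) \<Rightarrow> ('a \<Rightarrow> nat) \<Rightarrow> nat \<Rightarrow> 'a decomp_tree \<Rightarrow> table timed" where
  "dp_table u c B (Primitive a) = for_upto B (\<lambda>x. do {
     lt \<leftarrow> step (x < c a);
     ret (if lt then [u a] else [(0, 0)])
   })"
| "dp_table u c B (Parallel T1 T2) = do {
     L1 \<leftarrow> dp_table u c B T1; L2 \<leftarrow> dp_table u c B T2; combine add_label B L1 L2 }"
| "dp_table u c B (Series T1 T2) = do {
     L1 \<leftarrow> dp_table u c B T1; L2 \<leftarrow> dp_table u c B T2; combine min_label B L1 L2 }"

definition dp_algorithm :: "('v, 'a) bmfni \<Rightarrow> 'a decomp_tree \<Rightarrow> label list timed" where
  "dp_algorithm I T = do {
     L \<leftarrow> dp_table (cap I) (cost I) (budget I) T;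
     ret (L ! budget I)
   }"

definition dp_result :: "('v, 'a) bmfni \<Rightarrow> 'a decomp_tree \<Rightarrow> label list" where
  "dp_result I T = fst (dp_algorithm I T)"

definition dp_time :: "('v, 'a) bmfni \<Rightarrow> 'a decomp_tree \<Rightarrow> nat" where
  "dp_time I T = snd (dp_algorithm I T)"

end

theory Submission
  imports Defs
begin

text \<open>
  Correctness is a comparison of program and recurrence vertex by vertex of the decomposition
  tree.  The only point that needs an argument is \<open>discard_dominated\<close>: after lexicographic
  sorting, one pass that remembers the label kept last finds exactly the non-dominated labels
  (\<open>set_sweep\<close>).

  The running time rests on a bound for the size of the label sets.  Non-dominated labels with the
  same second component coincide, and the second component of a label of \<open>H\<close> is at most the sum of
  the capacities in \<open>H\<close>, hence at most \<open>m * U\<close>.  So every entry of every table is a list of at most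
  \<open>m * U + 1\<close> labels (\<open>length_dp_table_entry_le\<close>), no matter how many candidates it was chosen from.
  For one vertex and one budget \<open>x \<le> B\<close> there are therefore at most
  \<open>N = (B + 1) * (m * U + 1)\<^sup>2\<close> candidates, and sorting them takes \<open>O(N log N)\<close> operations, which
  dominates the rest.  Multiplying by the \<open>B + 1\<close> budgets and the fewer than \<open>2 * m\<close> vertices of the
  tree gives \<open>O(m * B * N log N)\<close>, and \<open>log N\<close> is \<open>O(log (B * m * U))\<close>.

  This bound depends on the instance only through \<open>B\<close>, \<open>m\<close> and \<open>U\<close>, so it bounds the worst case.
  It is kept as an inequality between natural numbers with a power \<open>2 ^ K \<ge> N\<close> in place of the
  logarithm up to \<open>dp_time_le\<close>; the passage to logarithms is made once, in \<open>dp_time_le_ln\<close>.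
\<close>

section \<open>Results and costs of the timed combinators\<close>

lemma timed_simps [simp]:
  "fst (ret v) = v" "snd (ret v) = 0" "fst (step v) = v" "snd (step v) = 1"
  "fst (bind_timed p f) = fst (f (fst p))" "snd (bind_timed p f) = snd p + snd (f (fst p))"
  by (simp_all add: ret_def step_def bind_timed_def)

lemma fst_map_timed [simp]: "fst (map_timed f xs) = map (\<lambda>x. fst (f x)) xs"
  by (induction xs) auto

lemma snd_map_timed [simp]: "snd (map_timed f xs) = (\<Sum>x\<leftarrow>xs. snd (f x))"
  by (induction xs) auto

lemma fst_for_upto [simp]: "fst (for_upto n f) = map (\<lambda>k. fst (f k)) [0..<Suc n]"
  by (simp add: for_upto_def del: upt_Suc)

lemma sum_list_le_length_mult:
  fixes f :: "'a \<Rightarrow> nat"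
  assumes "\<And>x. x \<in> set xs \<Longrightarrow> f x \<le> C"
  shows "(\<Sum>x\<leftarrow>xs. f x) \<le> length xs * C"
  using assms by (induction xs) (auto intro: add_mono)

lemma snd_for_upto_le:
  assumes "\<And>k. k \<le> n \<Longrightarrow> snd (f k) \<le> C"
  shows "snd (for_upto n f) \<le> Suc n * (C + 2)"
proof -
  have "snd (for_upto n f) = (\<Sum>k\<leftarrow>[0..<Suc n]. snd (f k) + 2)"
    by (simp add: for_upto_def del: upt_Suc)
  also have "\<dots> \<le> length [0..<Suc n] * (C + 2)"
    using assms by (intro sum_list_le_length_mult) (auto simp: less_Suc_eq_le simp del: upt_Suc)
  finally show ?thesis by simp
qed

lemma fst_all_pairs: "fst (all_pairs f R S) = concat (map (\<lambda>r. map (\<lambda>s. fst (f r s)) S) R)"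
  by (simp add: all_pairs_def)

lemma length_all_pairs: "length (fst (all_pairs f R S)) = length R * length S"
  by (simp add: fst_all_pairs length_concat comp_def sum_list_triv)

lemma snd_all_pairs:
  assumes "\<And>r s. snd (f r s) = 2"
  shows "snd (all_pairs f R S) = 2 * (length R * length S)"
  using assms by (simp add: all_pairs_def sum_list_triv)


section \<open>Discarding dominated labels\<close>

definition lex_less_eq :: "label \<Rightarrow> label \<Rightarrow> bool" where
  "lex_less_eq y z \<longleftrightarrow> fst y < fst z \<or> fst y = fst z \<and> snd y \<le> snd z"

lemma fst_lex_le [simp]: "fst (lex_le y z) = lex_less_eq y z"
  by (auto simp: lex_le_def lex_less_eq_def)

lemma snd_lex_le: "snd (lex_le y z) \<le> 3"
  by (auto simp: lex_le_def)

lemma lex_less_eq_linear: "\<not> lex_less_eq y z \<Longrightarrow> lex_less_eq z y"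
  by (auto simp: lex_less_eq_def)

lemma lex_less_eq_trans: "lex_less_eq x y \<Longrightarrow> lex_less_eq y z \<Longrightarrow> lex_less_eq x z"
  by (auto simp: lex_less_eq_def)

lemma set_merge_timed [simp]: "set (fst (merge_timed xs ys)) = set xs \<union> set ys"
  by (induction xs ys rule: merge_timed.induct) auto

lemma length_merge_timed [simp]: "length (fst (merge_timed xs ys)) = length xs + length ys"
  by (induction xs ys rule: merge_timed.induct) auto

lemma sorted_merge_timed:
  "sorted_wrt lex_less_eq xs \<Longrightarrow> sorted_wrt lex_less_eq ys
   \<Longrightarrow> sorted_wrt lex_less_eq (fst (merge_timed xs ys))"
proof (induction xs ys rule: merge_timed.induct)
  case (3 x xs y ys)
  then show ?case
    by (auto intro: lex_less_eq_trans dest: lex_less_eq_linear)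
qed auto

lemma snd_merge_timed_le: "snd (merge_timed xs ys) \<le> 3 * (length xs + length ys)"
proof (induction xs ys rule: merge_timed.induct)
  case (3 x xs y ys)
  have "snd (merge_timed xs (y # ys)) \<le> 3 * (length xs + length (y # ys))"
    "snd (merge_timed (x # xs) ys) \<le> 3 * (length (x # xs) + length ys)"
    using "3.IH"(1)[of True] "3.IH"(2)[of False] by blast+
  then show ?case
    using snd_lex_le[of x y] by simp
qed auto

lemma set_halve: "set (fst (halve xs)) \<union> set (snd (halve xs)) = set xs"
  by (induction xs rule: halve.induct) auto

lemma set_msort_timed [simp]: "set (fst (msort_timed xs)) = set xs"
proof (induction xs rule: msort_timed.induct)
  case (3 x y xs)
  then show ?case using set_halve[of xs] by auto
qed auto

lemma length_msort_timed [simp]: "length (fst (msort_timed xs)) = length xs"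
  by (induction xs rule: msort_timed.induct) (auto simp: length_fst_halve length_snd_halve)

lemma sorted_msort_timed: "sorted_wrt lex_less_eq (fst (msort_timed xs))"
  by (induction xs rule: msort_timed.induct) (auto intro: sorted_merge_timed)

text \<open>
  Bounding the depth of the recursion by any \<open>K\<close> with \<open>length xs \<le> 2 ^ K\<close>, rather than by a
  logarithm, lets the recurrence be solved exactly: halving a list of at least two elements lowers
  \<open>K\<close> by one, and merging costs at most three comparisons per element on each level.
\<close>

lemma snd_msort_timed_le: "length xs \<le> 2 ^ K \<Longrightarrow> snd (msort_timed xs) \<le> 3 * K * length xs"
proof (induction xs arbitrary: K rule: msort_timed.induct)
  case (3 x y xs)
  let ?zs = "x # y # xs" and ?l = "fst (halve (x # y # xs))" and ?r = "snd (halve (x # y # xs))"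
  obtain k where K: "K = Suc k"
    using "3.prems" by (cases K) auto
  have len: "length ?l + length ?r = length ?zs"
    unfolding length_fst_halve length_snd_halve by linarith
  have "length ?l \<le> 2 ^ k" "length ?r \<le> 2 ^ k"
    using "3.prems" unfolding length_fst_halve length_snd_halve K by simp_all
  then have "snd (msort_timed ?l) \<le> 3 * k * length ?l" "snd (msort_timed ?r) \<le> 3 * k * length ?r"
    using "3.IH"(1)[of k] "3.IH"(2)[of k] by blast+
  moreover have "snd (merge_timed (fst (msort_timed ?l)) (fst (msort_timed ?r))) \<le> 3 * length ?zs"
    using snd_merge_timed_le[of "fst (msort_timed ?l)" "fst (msort_timed ?r)"]
    by (simp only: length_msort_timed len)
  ultimately have "snd (msort_timed ?zs)
      \<le> 3 * k * length ?l + 3 * k * length ?r + 3 * length ?zs"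
    by (simp only: msort_timed.simps timed_simps)
  also have "\<dots> = 3 * k * (length ?l + length ?r) + 3 * length ?zs"
    by (simp only: add_mult_distrib2)
  also have "\<dots> = 3 * K * length ?zs"
    by (simp only: len K) (simp add: algebra_simps)
  finally show ?case .
qed auto

text \<open>
  In lexicographic order every label comes after all labels that dominate it.  Hence the label
  \<open>z\<close> kept last is non-dominated, and a later label is dominated by (or equal to) some kept
  label iff its second component is not below that of \<open>z\<close>.
\<close>

lemma set_sweep:
  "sorted_wrt lex_less_eq (z # ys) \<Longrightarrow> set (z # fst (sweep z ys)) = min_set (set (z # ys))"
proof (induction ys arbitrary: z)
  case Nil
  then show ?case by (auto simp: min_set_def)
next
  case (Cons y ys)
  have z_first: "\<forall>w \<in> set (y # ys). lex_less_eq z w"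
    and y_first: "\<forall>w \<in> set ys. lex_less_eq y w"
    using Cons.prems by auto
  show ?case
  proof (cases "snd y < snd z")
    case True
    \<comment> \<open>A later label dominated by \<open>z\<close> is also dominated by \<open>y\<close>, which lies strictly below \<open>z\<close> in the
      second component and lexicographically before the remaining labels.\<close>
    have "z \<in> min_set (set (z # y # ys))"
      using z_first by (fastforce simp: min_set_def less_le_not_le less_eq_prod_def lex_less_eq_def)
    moreover have "\<not> z < w" if w: "w \<in> min_set (set (y # ys))" for w
    proof
      assume "z < w"
      then have "snd y < snd w"
        using True by (auto simp: less_le_not_le less_eq_prod_def)
      moreover have "fst y \<le> fst w"
        using w y_first by (auto simp: min_set_def lex_less_eq_def)
      ultimately have "y < w"
        by (auto simp: less_le_not_le less_eq_prod_def)
      then show False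
        using w by (auto simp: min_set_def)
    qed
    ultimately have "min_set (set (z # y # ys)) = insert z (min_set (set (y # ys)))"
      by (auto simp: min_set_def)
    then show ?thesis
      using True Cons.IH[of y] Cons.prems by simp
  next
    case False
    \<comment> \<open>Whatever \<open>y\<close> dominates is dominated by \<open>z\<close> as well, so \<open>y\<close> can be dropped.\<close>
    then have "z \<le> y"
      using z_first by (auto simp: less_eq_prod_def lex_less_eq_def)
    then have "min_set (set (z # y # ys)) = min_set (set (z # ys))"
      unfolding min_set_def
      by (auto simp: order.order_iff_strict dest: less_trans)
    then show ?thesis
      using False Cons.IH[of z] Cons.prems by simp
  qed
qed

lemma sorted_sweep: "sorted_wrt (\<lambda>y z. snd z < snd y) (z # fst (sweep z ys))"
  by (induction ys arbitrary: z) (auto, fastforce)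

lemma snd_sweep [simp]: "snd (sweep z ys) = length ys"
  by (induction ys arbitrary: z) auto

lemma set_discard_dominated: "set (fst (discard_dominated xs)) = min_set (set xs)"
proof (cases "fst (msort_timed xs)")
  case Nil
  then have "set xs = {}"
    using set_msort_timed[of xs] by simp
  then show ?thesis
    using Nil by (simp add: discard_dominated_def min_set_def)
next
  case (Cons z zs)
  then have "set (fst (discard_dominated xs)) = set (z # fst (sweep z zs))"
    by (simp add: discard_dominated_def)
  also have "\<dots> = min_set (set (z # zs))"
    using sorted_msort_timed[of xs] Cons by (intro set_sweep) simp
  finally show ?thesis
    using Cons set_msort_timed[of xs] by simp
qed

lemma distinct_snd_discard_dominated: "distinct (map snd (fst (discard_dominated xs)))"
proof -
  let ?ys = "fst (discard_dominated xs)"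
  have "sorted_wrt (\<lambda>y z. snd z < snd y) ?ys"
  proof (cases "fst (msort_timed xs)")
    case (Cons z zs)
    then show ?thesis
      using sorted_sweep[of z zs] by (simp add: discard_dominated_def)
  qed (simp add: discard_dominated_def)
  then have "sorted_wrt (\<lambda>m n. n < m) (map snd ?ys)"
    by (simp add: sorted_wrt_map)
  then show ?thesis
    by (auto simp: sorted_wrt_iff_nth_less distinct_conv_nth nat_neq_iff)
qed

lemma snd_discard_dominated_le:
  assumes "length xs \<le> 2 ^ K"
  shows "snd (discard_dominated xs) \<le> (3 * K + 1) * length xs"
proof (cases "fst (msort_timed xs)")
  case Nil
  then show ?thesis
    using snd_msort_timed_le[OF assms] by (simp add: discard_dominated_def)
next
  case (Cons z zs)
  then have "length zs \<le> length xs"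
    using length_msort_timed[of xs] by simp
  then show ?thesis
    using Cons snd_msort_timed_le[OF assms] by (simp add: discard_dominated_def)
qed


section \<open>Combining two tables\<close>

lemma length_combine [simp]: "length (fst (combine f B L1 L2)) = Suc B"
  by (simp add: combine_def del: upt_Suc)

abbreviation candidates ::
    "(label \<Rightarrow> label \<Rightarrow> label timed) \<Rightarrow> table \<Rightarrow> table \<Rightarrow> nat \<Rightarrow> label list" where
  "candidates f L1 L2 x \<equiv>
     concat (map (\<lambda>k. fst (all_pairs f (L1 ! k) (L2 ! (x - k)))) [0..<Suc x])"

lemma nth_combine:
  "x \<le> B \<Longrightarrow> fst (combine f B L1 L2) ! x = fst (discard_dominated (candidates f L1 L2 x))"
  by (simp add: combine_def del: upt_Suc)

lemma set_candidates:
  "set (candidates f L1 L2 x) =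
     (\<Union>k\<in>{0..x}. {fst (f r s) | r s. r \<in> set (L1 ! k) \<and> s \<in> set (L2 ! (x - k))})"
proof -
  have "set [0..<Suc x] = {0..x}"
    by auto
  moreover have "set (fst (all_pairs f R S)) = {fst (f r s) | r s. r \<in> set R \<and> s \<in> set S}" for R S
    by (auto simp: fst_all_pairs simp del: split_paired_Ex)
  ultimately show ?thesis
    by (simp only: set_concat set_map UN_simps image_image)
qed

text \<open>
  With at most \<open>P\<close> labels per entry, each of the \<open>B + 1\<close> entries of the new table arises from
  at most \<open>N = (B + 1) * P\<^sup>2\<close> candidates, and sorting those dominates the cost.
\<close>

lemma snd_combine_le:
  assumes f: "\<And>r s. snd (f r s) = 2"
    and len: "\<And>x. x \<le> B \<Longrightarrow> length (L1 ! x) \<le> P" "\<And>x. x \<le> B \<Longrightarrow> length (L2 ! x) \<le> P"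
    and P: "P \<ge> 1" and N: "N = Suc B * P\<^sup>2" "N \<le> 2 ^ K"
  shows "snd (combine f B L1 L2) \<le> Suc B * ((3 * K + 8) * N)"
proof -
  let ?c = "\<lambda>x. for_upto x (\<lambda>k. bind_timed (step (x - k)) (\<lambda>j. all_pairs f (L1 ! k) (L2 ! j)))"
  have pairs: "length (L1 ! k) * length (L2 ! (x - k)) \<le> P\<^sup>2" if "k \<le> x" "x \<le> B" for k x
    unfolding power2_eq_square using that by (intro mult_mono len) auto
  have "snd (?c x) + snd (discard_dominated (candidates f L1 L2 x)) \<le> (3 * K + 6) * N"
    if x: "x \<le> B" for x
  proof -
    have "length (candidates f L1 L2 x) \<le> length [0..<Suc x] * P\<^sup>2"
      unfolding length_concat map_map comp_def length_all_pairs
      using pairs x by (intro sum_list_le_length_mult) (auto simp: less_Suc_eq_le simp del: upt_Suc)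
    also have "\<dots> \<le> N"
      using x by (simp add: N(1) del: upt_Suc)
    finally have cands: "length (candidates f L1 L2 x) \<le> N" .
    have "snd (?c x) \<le> Suc x * ((1 + 2 * P\<^sup>2) + 2)"
      using pairs x by (intro snd_for_upto_le) (auto simp: snd_all_pairs[OF f])
    also have "\<dots> \<le> Suc B * (5 * P\<^sup>2)"
      using x P by (intro mult_mono) auto
    finally have "snd (?c x) \<le> 5 * N"
      by (simp add: N(1) algebra_simps)
    moreover have "snd (discard_dominated (candidates f L1 L2 x)) \<le> (3 * K + 1) * N"
    proof (rule order_trans)
      show "snd (discard_dominated (candidates f L1 L2 x))
          \<le> (3 * K + 1) * length (candidates f L1 L2 x)"
        using cands N(2) by (intro snd_discard_dominated_le) linarith
      show "(3 * K + 1) * length (candidates f L1 L2 x) \<le> (3 * K + 1) * N"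
        using cands by (rule mult_le_mono2)
    qed
    ultimately show ?thesis by (simp add: algebra_simps)
  qed
  then have "snd (combine f B L1 L2) \<le> Suc B * ((3 * K + 6) * N + 2)"
    unfolding combine_def by (intro snd_for_upto_le) (simp del: upt_Suc)
  also have "N \<ge> 1"
    using P by (simp only: N(1)) (simp add: Suc_le_eq)
  then have "Suc B * ((3 * K + 6) * N + 2) \<le> Suc B * ((3 * K + 8) * N)"
    by (intro mult_le_mono2) (simp add: algebra_simps)
  finally show ?thesis .
qed


section \<open>Label sets and cost of a decomposition tree\<close>

primrec num_leaves :: "'a decomp_tree \<Rightarrow> nat" where
  "num_leaves (Primitive a) = 1"
| "num_leaves (Parallel T1 T2) = num_leaves T1 + num_leaves T2"
| "num_leaves (Series T1 T2) = num_leaves T1 + num_leaves T2"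

lemma length_dp_table [simp]: "length (fst (dp_table u c B T)) = Suc B"
  by (cases T) (simp_all del: upt_Suc)

lemma fst_add_label [simp]: "fst (add_label r s) = r + s"
  and fst_min_label [simp]: "fst (min_label r s) = inf r s"
  and snd_add_label [simp]: "snd (add_label r s) = 2"
  and snd_min_label [simp]: "snd (min_label r s) = 2"
  by (simp_all add: add_label_def min_label_def plus_prod_def inf_prod_def inf_min)

lemma set_dp_table:
  "x \<le> B \<Longrightarrow> set (fst (dp_table u c B T) ! x) = labels u c T x"
proof (induction T arbitrary: x)
  case (Primitive a)
  then show ?case by (simp del: upt_Suc)
next
  case (Parallel T1 T2)
  show ?case
    using Parallel
    by (simp add: nth_combine set_discard_dominated set_candidates oplus_def del: upt_Suc set_concat)
next
  case (Series T1 T2)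
  show ?case
    using Series
    by (simp add: nth_combine set_discard_dominated set_candidates odot_def del: upt_Suc set_concat)
qed

text \<open>
  The labels stand for flow values, which never exceed the sum of all capacities: parallel
  composition adds this bound for the two parts, and series composition can only do better.
\<close>

lemma snd_label_le:
  assumes "\<And>a. a \<in> set_decomp_tree T \<Longrightarrow> snd (u a) \<le> U" "z \<in> labels u c T x"
  shows "snd z \<le> num_leaves T * U"
  using assms
proof (induction T arbitrary: z x)
  case (Primitive a)
  then show ?case by (auto split: if_splits)
next
  case (Parallel T1 T2)
  then obtain k r s where rs: "r \<in> labels u c T1 k" "s \<in> labels u c T2 (x - k)" "z = r + s"
    by (auto simp: min_set_def oplus_def)
  then have "snd r \<le> num_leaves T1 * U" "snd s \<le> num_leaves T2 * U"
    using Parallel.IH Parallel.prems(1) by auto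
  then show ?case
    using rs(3) by (simp add: algebra_simps)
next
  case (Series T1 T2)
  then obtain k r s where rs: "r \<in> labels u c T1 k" "s \<in> labels u c T2 (x - k)" "z = inf r s"
    by (auto simp: min_set_def odot_def)
  then have "snd r \<le> num_leaves T1 * U"
    using Series.IH(1) Series.prems(1) by auto
  then show ?case
    using rs(3) by (simp add: algebra_simps inf_min)
qed

lemma distinct_snd_dp_table:
  "x \<le> B \<Longrightarrow> distinct (map snd (fst (dp_table u c B T) ! x))"
  by (cases T) (simp_all add: nth_combine distinct_snd_discard_dominated del: upt_Suc)

text \<open>
  The labels of one entry have pairwise different second components, so the bound on these
  components also bounds the number of labels, however many candidates there were.
\<close>

lemma length_dp_table_entry_le:
  assumes u: "\<And>a. a \<in> set_decomp_tree T \<Longrightarrow> snd (u a) \<le> U"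
    and m: "num_leaves T \<le> m" and x: "x \<le> B"
  shows "length (fst (dp_table u c B T) ! x) \<le> Suc (m * U)"
proof -
  have "length (fst (dp_table u c B T) ! x) = card (snd ` labels u c T x)"
    using distinct_card[OF distinct_snd_dp_table[OF x, of u c T]] set_dp_table[OF x, of u c T]
    by simp
  also have "\<dots> \<le> card {..num_leaves T * U}"
    using snd_label_le[OF u] by (intro card_mono) auto
  also have "\<dots> \<le> Suc (m * U)"
    using m by (simp only: card_atMost Suc_le_mono mult_le_mono1)
  finally show ?thesis .
qed

text \<open>
  A binary tree has fewer than twice as many vertices as leaves, and every vertex costs at most
  \<open>W\<close>; the extra \<open>W\<close> on the left is the surplus that pays for the root in the induction.
\<close>

lemma snd_dp_table_le:
  assumes "\<And>a. a \<in> set_decomp_tree T \<Longrightarrow> snd (u a) \<le> U" "num_leaves T \<le> m"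
    and N: "N = Suc B * (Suc (m * U))\<^sup>2" "N \<le> 2 ^ K" and W: "W = Suc B * ((3 * K + 8) * N)"
  shows "snd (dp_table u c B T) + W \<le> 2 * num_leaves T * W"
  using assms(1,2)
proof (induction T)
  case (Primitive a)
  have "snd (dp_table u c B (Primitive a)) \<le> Suc B * (1 + 2)"
    unfolding dp_table.simps by (intro snd_for_upto_le) simp
  also have "N \<ge> 1"
    by (simp only: N(1)) (simp add: Suc_le_eq)
  then have "Suc B * (1 + 2) \<le> W"
    unfolding W by (intro mult_le_mono2) (simp add: add_mult_distrib)
  finally show ?case by simp
next
  case (Parallel T1 T2)
  let ?L1 = "fst (dp_table u c B T1)" and ?L2 = "fst (dp_table u c B T2)"
  have len: "length (fst (dp_table u c B T) ! x) \<le> Suc (m * U)"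
    if "T \<in> {T1, T2}" "x \<le> B" for x T
    using that Parallel.prems by (intro length_dp_table_entry_le) auto
  have "snd (combine add_label B ?L1 ?L2) \<le> W"
    unfolding W using N by (intro snd_combine_le[where P = "Suc (m * U)"] len) simp_all
  moreover have "snd (dp_table u c B T1) + W \<le> 2 * num_leaves T1 * W"
    "snd (dp_table u c B T2) + W \<le> 2 * num_leaves T2 * W"
    using Parallel.IH Parallel.prems by simp_all
  ultimately show ?case
    by (simp add: add_mult_distrib)
next
  case (Series T1 T2)
  let ?L1 = "fst (dp_table u c B T1)" and ?L2 = "fst (dp_table u c B T2)"
  have len: "length (fst (dp_table u c B T) ! x) \<le> Suc (m * U)"
    if "T \<in> {T1, T2}" "x \<le> B" for x T
    using that Series.prems by (intro length_dp_table_entry_le) auto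
  have "snd (combine min_label B ?L1 ?L2) \<le> W"
    unfolding W using N by (intro snd_combine_le[where P = "Suc (m * U)"] len) simp_all
  moreover have "snd (dp_table u c B T1) + W \<le> 2 * num_leaves T1 * W"
    "snd (dp_table u c B T2) + W \<le> 2 * num_leaves T2 * W"
    using Series.IH Series.prems by simp_all
  ultimately show ?case
    by (simp add: add_mult_distrib)
qed


section \<open>Worst case over all instances\<close>

lemma decomposes_arcs:
  "decomposes T H s t \<Longrightarrow>
     arcs H = set_decomp_tree T \<and> finite (arcs H) \<and> card (arcs H) = num_leaves T"
  by (induction rule: decomposes.induct) (auto simp: card_Un_disjoint)

lemma sp_instances_tree:
  assumes "(I, T) \<in> sp_instances B m U"
  shows "num_leaves T = m" "budget I = B" "a \<in> set_decomp_tree T \<Longrightarrow> snd (cap I a) \<le> U"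
proof -
  have arcs: "arcs (graph I) = set_decomp_tree T" "finite (arcs (graph I))"
      "card (arcs (graph I)) = num_leaves T"
    and I: "budget I = B" "num_arcs I = m" "max_cap I = U"
    using assms decomposes_arcs[of T "graph I"] by (auto simp: sp_instances_def)
  show "num_leaves T = m" "budget I = B"
    using arcs I by (auto simp: num_arcs_def)
  show "snd (cap I a) \<le> U" if "a \<in> set_decomp_tree T"
    unfolding I(3)[symmetric] max_cap_def using arcs that by (intro Max_ge) auto
qed

lemma dp_time_le:
  assumes "(I, T) \<in> sp_instances B m U"
    and "Suc B * (Suc (m * U))\<^sup>2 \<le> 2 ^ K"
  shows "dp_time I T \<le> 2 * m * (Suc B * ((3 * K + 8) * (Suc B * (Suc (m * U))\<^sup>2)))"
proof -
  note tree = sp_instances_tree[OF assms(1)]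
  let ?W = "Suc B * ((3 * K + 8) * (Suc B * (Suc (m * U))\<^sup>2))"
  have "dp_time I T = snd (dp_table (cap I) (cost I) B T)"
    by (simp add: dp_time_def dp_algorithm_def tree(2))
  also have "\<dots> \<le> snd (dp_table (cap I) (cost I) B T) + ?W"
    by (rule le_add1)
  also have "\<dots> \<le> 2 * num_leaves T * ?W"
    using tree(1) by (intro snd_dp_table_le[OF tree(3) _ refl assms(2) refl]) auto
  finally show ?thesis
    by (simp only: tree(1))
qed

lemma ln_2_ge_half: "ln (2 :: real) \<ge> 1 / 2"
proof -
  have "1 \<le> ln (4 :: real)"
    using exp_le by (subst ln_ge_iff) auto
  also have "ln (4 :: real) = 2 * ln 2"
    using ln_realpow[of 2 2] by simp
  finally show ?thesis by simp
qed

text \<open>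
  Up to constant factors the number \<open>N\<close> of candidates is \<open>B * m\<^sup>2 * U\<^sup>2\<close>, which is at most
  \<open>(B * m * U)\<^sup>2\<close>; hence its logarithm is of the order of \<open>ln (B * m * U)\<close>.  The bound \<open>16 \<le> B\<close>
  is a convenient one that lets \<open>ln (B * m * U)\<close> absorb all additive constants.
\<close>

lemma dp_time_le_ln:
  assumes "(I, T) \<in> sp_instances B m U" "B \<ge> 16" "m \<ge> 1" "U \<ge> 1"
  shows "real (dp_time I T)
    \<le> 832 * (real B ^ 2 * real m ^ 3 * real U ^ 2 * ln (real (B * m * U)))"
proof -
  define N where "N = Suc B * (Suc (m * U))\<^sup>2"
  define Q where "Q = real (B * m * U)"
  have mU: "m * U \<ge> 1"
    using assms by simp
  have "Q \<ge> 16"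
    using mult_le_mono[OF assms(2) mU] by (simp add: Q_def mult.assoc flip: of_nat_mult)
  have N_pos: "N \<ge> 1"
    by (simp only: N_def) (simp add: Suc_le_eq)
  obtain k where k: "2 ^ k \<le> N" "N < 2 ^ (k + 1)"
    using ex_power_ivl1[of 2 N] N_pos by auto
  have "N \<le> (2 * B) * (2 * (m * U))\<^sup>2"
    unfolding N_def using assms mU by (intro mult_mono power_mono) auto
  then have N_le_nat: "N \<le> 8 * (B * (m * U)\<^sup>2)"
    by (simp add: power_mult_distrib)
  then have N_le: "real N \<le> 8 * (real B * real m ^ 2 * real U ^ 2)"
    by (simp add: power_mult_distrib mult.assoc flip: of_nat_mult of_nat_power)
  have "B * (m * U)\<^sup>2 \<le> B\<^sup>2 * (m * U)\<^sup>2"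
    by (intro mult_le_mono1) (simp add: power2_eq_square)
  with N_le_nat have "N \<le> 8 * (B * m * U)\<^sup>2"
    unfolding power_mult_distrib mult.assoc by linarith
  then have "real N \<le> 8 * Q ^ 2"
    by (simp add: Q_def flip: of_nat_mult of_nat_power)
  moreover have "2 ^ k \<le> real N"
    using k(1) by (metis of_nat_le_iff of_nat_power of_nat_numeral)
  ultimately have "2 ^ (k + 1) \<le> 16 * Q ^ 2"
    unfolding power_add power_one_right by linarith
  also have "\<dots> \<le> Q ^ 3"
    using \<open>Q \<ge> 16\<close> by (simp add: power3_eq_cube power2_eq_square mult_right_mono)
  finally have "ln (2 ^ (k + 1)) \<le> ln (Q ^ 3)"
    using \<open>Q \<ge> 16\<close> by (subst ln_le_cancel_iff) auto
  then have "real (k + 1) * ln 2 \<le> 3 * ln Q"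
    using \<open>Q \<ge> 16\<close> by (simp only: ln_realpow zero_less_numeral)
  moreover have "real (k + 1) * (1 / 2) \<le> real (k + 1) * ln 2"
    using ln_2_ge_half by (intro mult_left_mono) auto
  ultimately have "real (k + 1) * (1 / 2) \<le> 3 * ln Q"
    by (rule order_trans[rotated])
  then have K: "real (k + 1) \<le> 6 * ln Q"
    by simp
  have "1 \<le> ln Q"
    using \<open>Q \<ge> 16\<close> exp_le by (subst ln_ge_iff) auto
  with K have K': "real (3 * (k + 1) + 8) \<le> 26 * ln Q"
    by simp
  have "real (dp_time I T) \<le> real (2 * m * (Suc B * ((3 * (k + 1) + 8) * N)))"
    using dp_time_le[OF assms(1), of "k + 1"] k(2)
    unfolding N_def[symmetric] of_nat_le_iff by simp
  also have "\<dots> = 2 * real m * (real (Suc B) * (real (3 * (k + 1) + 8) * real N))"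
    by (simp only: of_nat_mult of_nat_numeral)
  also have "\<dots> \<le> 2 * real m * ((2 * real B) *
      (26 * ln Q * (8 * (real B * real m ^ 2 * real U ^ 2))))"
    using assms(2) \<open>1 \<le> ln Q\<close> by (intro mult_left_mono mult_mono K' N_le) auto
  also have "\<dots> = 832 * (real B ^ 2 * real m ^ 3 * real U ^ 2 * ln Q)"
    by (simp add: power2_eq_square power3_eq_cube)
  finally show ?thesis
    unfolding Q_def .
qed

theorem theorem6:
  shows "(\<forall>B m U. \<forall>(I, T) \<in> (sp_instances B m U :: (('v, 'a) bmfni \<times> 'a decomp_tree) set).
            set (dp_result I T) = labels (cap I) (cost I) T B) \<and>
         (\<forall>B m U. bdd_above ((\<lambda>(I, T). dp_time I T) `
            (sp_instances B m U :: (('v, 'a) bmfni \<times> 'a decomp_tree) set))) \<and>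
         (\<lambda>(B, m, U). real (SUP (I, T) \<in>
             (sp_instances B m U :: (('v, 'a) bmfni \<times> 'a decomp_tree) set). dp_time I T))
         \<in> O[sequentially \<times>\<^sub>F sequentially \<times>\<^sub>F sequentially](\<lambda>(B, m, U).
               real B ^ 2 * real m ^ 3 * real U ^ 2 * ln (real (B * m * U)))"
proof (intro conjI allI)
  fix B m U
  show "\<forall>(I, T) \<in> (sp_instances B m U :: (('v, 'a) bmfni \<times> 'a decomp_tree) set).
      set (dp_result I T) = labels (cap I) (cost I) T B"
  proof clarify
    fix I :: "('v, 'a) bmfni" and T
    assume "(I, T) \<in> sp_instances B m U"
    then show "set (dp_result I T) = labels (cap I) (cost I) T B"
      by (simp add: dp_result_def dp_algorithm_def set_dp_table sp_instances_tree(2))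
  qed
  obtain M where "\<And>I T. (I, T) \<in> (sp_instances B m U :: (('v, 'a) bmfni \<times> 'a decomp_tree) set)
      \<Longrightarrow> dp_time I T \<le> M"
    using dp_time_le[OF _ less_imp_le[OF less_exp]] by blast
  then show "bdd_above ((\<lambda>(I, T). dp_time I T) `
      (sp_instances B m U :: (('v, 'a) bmfni \<times> 'a decomp_tree) set))"
    by (auto intro: bdd_aboveI2[where M = M])
next
  let ?g = "\<lambda>(B, m, U). real B ^ 2 * real m ^ 3 * real U ^ 2 * ln (real (B * m * U))"
  have bound: "real (SUP (I, T) \<in> (sp_instances B m U :: (('v, 'a) bmfni \<times> 'a decomp_tree) set).
      dp_time I T) \<le> 832 * ?g (B, m, U)" if "B \<ge> 16" "m \<ge> 1" "U \<ge> 1" for B m U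
  proof -
    let ?S = "(\<lambda>(I, T). dp_time I T) `
      (sp_instances B m U :: (('v, 'a) bmfni \<times> 'a decomp_tree) set)"
    show ?thesis
    proof (cases "?S = {}")
      case True
      \<comment> \<open>The supremum of the empty set of natural numbers is \<open>0\<close>.\<close>
      have "B * m * U \<ge> 1"
        using that by simp
      then have "ln (real (B * m * U)) \<ge> 0"
        by (intro ln_ge_zero) linarith
      then show ?thesis
        unfolding True by (simp add: Sup_nat_def)
    next
      case False
      have le: "real x \<le> 832 * ?g (B, m, U)" if "x \<in> ?S" for x
        using that dp_time_le_ln[OF _ \<open>B \<ge> 16\<close> \<open>m \<ge> 1\<close> \<open>U \<ge> 1\<close>] by auto
      then have "Sup ?S \<le> nat \<lfloor>832 * ?g (B, m, U)\<rfloor>"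
        using False by (intro cSup_least le_nat_floor) auto
      moreover obtain x where "x \<in> ?S"
        using False by blast
      then have "0 \<le> 832 * ?g (B, m, U)"
        using le order_trans[OF of_nat_0_le_iff] by blast
      ultimately show ?thesis
        by linarith
    qed
  qed
  show "(\<lambda>(B, m, U). real (SUP (I, T) \<in>
      (sp_instances B m U :: (('v, 'a) bmfni \<times> 'a decomp_tree) set). dp_time I T))
    \<in> O[sequentially \<times>\<^sub>F sequentially \<times>\<^sub>F sequentially](?g)"
  proof (rule bigoI)
    \<comment> \<open>The product filter lets all three parameters grow together, so each may be assumed large.\<close>
    have "\<forall>\<^sub>F (p :: nat \<times> nat \<times> nat) in sequentially \<times>\<^sub>F sequentially \<times>\<^sub>F sequentially.
        fst p \<ge> 16 \<and> (fst (snd p) \<ge> 1 \<and> snd (snd p) \<ge> 1)"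
      by (intro eventually_prodI eventually_ge_at_top)
    then show "\<forall>\<^sub>F p in sequentially \<times>\<^sub>F sequentially \<times>\<^sub>F sequentially.
        norm ((\<lambda>(B, m, U). real (SUP (I, T) \<in>
          (sp_instances B m U :: (('v, 'a) bmfni \<times> 'a decomp_tree) set). dp_time I T)) p)
        \<le> 832 * norm (?g p)"
    proof eventually_elim
      case (elim p)
      obtain B m U where p: "p = (B, m, U)"
        by (cases p) auto
      show ?case
        using elim bound[of B m U] abs_ge_self[of "?g (B, m, U)"] unfolding p by simp
    qed
  qed
qed

end
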